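(* Let $(\mathfrak g,\pi)$ and $(\mathfrak h,\mu)$ be $3$-Lie algebras, let $f\in\mathrm{Hom}(\mathfrak g,\mathfrak h)$ be a $3$-Lie algebra morphism, and let $f'\in\mathrm{Hom}(\mathfrak g,\mathfrak h)$ be a linear map. Then $f+f'$ is a $3$-Lie algebra morphism if and only if $f'$ is a Maurer-Cartan element of the twisted $L_\infty$-algebra $(F,\{l_k^f\}_{k\ge1})$, where $F=\bigoplus_{n\ge0}\mathrm{Hom}\big((\wedge^2\mathfrak g)^{\otimes n}\wedge\mathfrak g,\mathfrak h\big)$ and $$l_k^f(x_1,\dots,x_k)=\sum_{n=0}^{\infty}\frac1{n!}\,l_{k+n}(\underbrace{f,\dots,f}_{n},x_1,\dots,x_k),$$ with $l_1(a_1)=[\pi,a_1]_{\mathsf R}$, $l_3(a_1,a_2,a_3)=[[[\mu,a_1]_{\mathsf R},a_2]_{\mathsf R},a_3]_{\mathsf R}$, $l_2=0$ and $l_k=0$ for $k\ge4$.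
   Context: All vector spaces are over a field of characteristic $0$. A $3$-Lie algebra is a vector space $\mathfrak g$ with a linear map $\pi:\wedge^3\mathfrak g\to\mathfrak g$ such that $\pi(x_1,x_2,\pi(x_3,x_4,x_5))=\pi(\pi(x_1,x_2,x_3),x_4,x_5)+\pi(x_3,\pi(x_1,x_2,x_4),x_5)+\pi(x_3,x_4,\pi(x_1,x_2,x_5))$ for all $x_i\in\mathfrak g$. A $3$-Lie algebra morphism $(\mathfrak g,\pi)\to(\mathfrak h,\mu)$ is a linear map $f$ with $f(\pi(x,y,z))=\mu(f(x),f(y),f(z))$ for all $x,y,z\in\mathfrak g$. Notation: for a vector space $V$, $(\wedge^2V)^{\otimes n}\wedge V$ means $V$ if $n=0$ and $(\wedge^2V)^{\otimes(n-1)}\otimes\wedge^3V$ if $n\ge1$. Put $C^n(V,V)=\mathrm{Hom}((\wedge^2V)^{\otimes n}\wedge V,V)$, in degree $n\ge0$. The space $\bigoplus_nC^n(V,V)$ is a graded Lie algebra with $[A,B]_{\mathsf R}=A\circ B-(-1)^{pq}B\circ A$ for $A\in C^p(V,V)$, $B\in C^q(V,V)$, where, for $\mathfrak X_i=x_i\wedge y_i\in\wedge^2V$, $x\in V$, $$\begin{aligned}(A\circ B)(\mathfrak X_1,\dots,\mathfrak X_{p+q},x)=&\sum_{k=1}^p(-1)^{(k-1)q}\sum_{\sigma\in\mathbb S(k-1,q)}(-1)^\sigma A\big(\mathfrak X_{\sigma(1)},\dots,\mathfrak X_{\sigma(k-1)},B(\mathfrak X_{\sigma(k)},\dots,\mathfrak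 X_{\sigma(k+q-1)},x_{k+q})\wedge y_{k+q},\mathfrak X_{k+q+1},\dots,\mathfrak X_{p+q},x\big)\\&+\sum_{k=1}^p(-1)^{(k-1)q}\sum_{\sigma\in\mathbb S(k-1,q)}(-1)^\sigma A\big(\mathfrak X_{\sigma(1)},\dots,\mathfrak X_{\sigma(k-1)},x_{k+q}\wedge B(\mathfrak X_{\sigma(k)},\dots,\mathfrak X_{\sigma(k+q-1)},y_{k+q}),\mathfrak X_{k+q+1},\dots,\mathfrak X_{p+q},x\big)\\&+\sum_{\sigma\in\mathbb S(p,q)}(-1)^{pq}(-1)^\sigma A\big(\mathfrak X_{\sigma(1)},\dots,\mathfrak X_{\sigma(p)},B(\mathfrak X_{\sigma(p+1)},\dots,\mathfrak X_{\sigma(p+q)},x)\big),\end{aligned}$$ with $\mathbb S(i,j)$ the set of $(i,j)$-shuffles. The brackets in the claim are taken in $\bigoplus_nC^n(\mathfrak g\oplus\mathfrak h,\mathfrak g\oplus\mathfrak h)$, where $Q\in\mathrm{Hom}((\wedge^2\mathfrak g)^{\otimes n}\wedge\mathfrak g,\mathfrak h)$ is identified with the map $((x_1,a_1)\wedge(y_1,b_1),\dots,(x_n,a_n)\wedge(y_n,b_n),(x,a))\mapsto(0,Q(x_1\wedge y_1,\dots,x_n\wedge y_n,x))$, and $\pi((x,a),(y,b),(z,c))=(\pi(x,y,z),0)$, $\mu((x,a),(y,b),(z,c))=(0,\mu(a,b,c))$. The maps $l_k$ take values in $F$, and $F$, graded by $n$, is with them an $L_\infty$-algebra (operations of degree $1$,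 graded symmetric, satisfying the generalized Jacobi identities); since $f$ is a Maurer-Cartan element of it, $(F,\{l_k^f\})$ is again an $L_\infty$-algebra. A Maurer-Cartan element of an $L_\infty$-algebra $(V,\{l_k\})$ (with only finitely many nonzero $l_k$) is a degree $0$ element $\alpha\in V^0$ with $\sum_{k\ge1}\frac1{k!}l_k(\alpha,\dots,\alpha)=0$. *)

theory Defs
  imports
    "HOL-Analysis.Product_Vector"
    "HOL-Combinatorics.Permutations"
    "HOL-Library.Function_Algebras"
    "HOL-Library.Groups_Big_Fun"
begin

section \<open>3-Lie algebras\<close>

locale three_lie_algebra = vector_space scale
  for scale :: "'k::field_char_0 \<Rightarrow> 'v::ab_group_add \<Rightarrow> 'v" +
  fixes br :: "'v \<Rightarrow> 'v \<Rightarrow> 'v \<Rightarrow> 'v"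
  assumes linear_1: "Vector_Spaces.linear scale scale (\<lambda>x. br x y z)"
    and linear_2: "Vector_Spaces.linear scale scale (\<lambda>y. br x y z)"
    and linear_3: "Vector_Spaces.linear scale scale (\<lambda>z. br x y z)"
    and alternating: "x = y \<or> x = z \<or> y = z \<Longrightarrow> br x y z = 0"
    and fundamental_identity:
      "br x1 x2 (br x3 x4 x5) =
        br (br x1 x2 x3) x4 x5 + br x3 (br x1 x2 x4) x5 + br x3 x4 (br x1 x2 x5)"

definition three_lie_morphism ::
  "('k::field_char_0 \<Rightarrow> 'g::ab_group_add \<Rightarrow> 'g) \<Rightarrow> ('g \<Rightarrow> 'g \<Rightarrow> 'g \<Rightarrow> 'g) \<Rightarrow>
   ('k \<Rightarrow> 'h::ab_group_add \<Rightarrow> 'h) \<Rightarrow> ('h \<Rightarrow> 'h \<Rightarrow> 'h \<Rightarrow> 'h) \<Rightarrow> ('g \<Rightarrow> 'h) \<Rightarrow> bool" where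
  "three_lie_morphism sg \<pi> sh \<mu> f \<longleftrightarrow>
     Vector_Spaces.linear sg sh f \<and> (\<forall>x y z. f (\<pi> x y z) = \<mu> (f x) (f y) (f z))"


section \<open>Cochains\<close>

text \<open>
  A cochain is a function \<open>A [(x\<^sub>1, y\<^sub>1), \<dots>, (x\<^sub>n, y\<^sub>n)] x\<close>, standing for
  \<open>A (x\<^sub>1 \<and> y\<^sub>1, \<dots>, x\<^sub>n \<and> y\<^sub>n, x)\<close>. Its component of degree \<open>n\<close> is its restriction to lists of
  length \<open>n\<close>, so that the elements of a direct sum over all degrees are again such functions.
  Addition and zero are pointwise.
\<close>

type_synonym ('v, 'w) cochain = "('v \<times> 'v) list \<Rightarrow> 'v \<Rightarrow> 'w"

definition cochain_scale :: "('k \<Rightarrow> 'w \<Rightarrow> 'w) \<Rightarrow> 'k \<Rightarrow> ('v, 'w) cochain \<Rightarrow> ('v, 'w) cochain" where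
  "cochain_scale s c A = (\<lambda>Xs x. s c (A Xs x))"

text \<open>
  \<open>Hom((\<and>\<^sup>2V)\<^sup>\<otimes>\<^sup>n \<and> V, W)\<close>: by the universal property, its elements are the maps that are linear
  in each of the \<open>2n + 1\<close> arguments, alternating in each pair and, since the last factor is
  \<open>\<and>\<^sup>3V\<close> for \<open>n \<ge> 1\<close>, alternating in the last pair together with the final argument.
\<close>

definition hom_wedge ::
  "('k::field_char_0 \<Rightarrow> 'v::ab_group_add \<Rightarrow> 'v) \<Rightarrow> ('k \<Rightarrow> 'w::ab_group_add \<Rightarrow> 'w) \<Rightarrow> nat \<Rightarrow>
   ('v, 'w) cochain set" where
  "hom_wedge s1 s2 n = {A.
     (\<forall>Xs x. length Xs \<noteq> n \<longrightarrow> A Xs x = 0) \<and>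
     (\<forall>Xs x i. length Xs = n \<and> i < n \<longrightarrow>
        Vector_Spaces.linear s1 s2 (\<lambda>u. A (Xs[i := (u, snd (Xs ! i))]) x) \<and>
        Vector_Spaces.linear s1 s2 (\<lambda>u. A (Xs[i := (fst (Xs ! i), u)]) x)) \<and>
     (\<forall>Xs. length Xs = n \<longrightarrow> Vector_Spaces.linear s1 s2 (A Xs)) \<and>
     (\<forall>Xs x i. length Xs = n \<and> i < n \<and> fst (Xs ! i) = snd (Xs ! i) \<longrightarrow> A Xs x = 0) \<and>
     (\<forall>Xs x. length Xs = n \<and> n \<ge> 1 \<and> (x = fst (last Xs) \<or> x = snd (last Xs)) \<longrightarrow> A Xs x = 0)}"

definition shuffle_perms :: "nat \<Rightarrow> nat \<Rightarrow> (nat \<Rightarrow> nat) set" where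
  "shuffle_perms i j = {\<sigma>. \<sigma> permutes {1..i+j} \<and>
     strict_mono_on {1..i} \<sigma> \<and> strict_mono_on {i+1..i+j} \<sigma>}"

text \<open>\<open>X i\<close> is the \<open>i\<close>-th pair of the list, counted from 1 as in the shuffles.\<close>

definition cochain_comp ::
  "('k::field_char_0 \<Rightarrow> 'v::ab_group_add \<Rightarrow> 'v) \<Rightarrow> nat \<Rightarrow> nat \<Rightarrow>
   ('v, 'v) cochain \<Rightarrow> ('v, 'v) cochain \<Rightarrow> ('v, 'v) cochain" where
  "cochain_comp s p q A B = (\<lambda>Xs x.
     if length Xs \<noteq> p + q then 0 else
     let X = (\<lambda>i. Xs ! (i - 1)) in
       (\<Sum>k=1..p. s ((-1) ^ ((k-1)*q)) (\<Sum>\<sigma>\<in>shuffle_perms (k-1) q. s (of_int (sign \<sigma>))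
         (A (map (\<lambda>i. X (\<sigma> i)) [1..<k]
             @ [(B (map (\<lambda>i. X (\<sigma> i)) [k..<k+q]) (fst (X (k+q))), snd (X (k+q)))]
             @ map X [k+q+1..<p+q+1]) x)))
     + (\<Sum>k=1..p. s ((-1) ^ ((k-1)*q)) (\<Sum>\<sigma>\<in>shuffle_perms (k-1) q. s (of_int (sign \<sigma>))
         (A (map (\<lambda>i. X (\<sigma> i)) [1..<k]
             @ [(fst (X (k+q)), B (map (\<lambda>i. X (\<sigma> i)) [k..<k+q]) (snd (X (k+q))))]
             @ map X [k+q+1..<p+q+1]) x)))
     + (\<Sum>\<sigma>\<in>shuffle_perms p q. s ((-1) ^ (p*q)) (s (of_int (sign \<sigma>))
         (A (map (\<lambda>i. X (\<sigma> i)) [1..<p+1])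
            (B (map (\<lambda>i. X (\<sigma> i)) [p+1..<p+q+1]) x)))))"

text \<open>
  The bilinear extension of \<open>[A, B] = A \<circ> B - (-1)\<^sup>p\<^sup>q B \<circ> A\<close> from homogeneous elements to the direct
  sum. Note that \<open>cochain_comp s p q A B\<close> only depends on the components of degree \<open>p\<close> of \<open>A\<close>
  and of degree \<open>q\<close> of \<open>B\<close>.
\<close>

definition R_bracket ::
  "('k::field_char_0 \<Rightarrow> 'v::ab_group_add \<Rightarrow> 'v) \<Rightarrow>
   ('v, 'v) cochain \<Rightarrow> ('v, 'v) cochain \<Rightarrow> ('v, 'v) cochain" where
  "R_bracket s A B = (\<lambda>Xs x. \<Sum>(p, q) | p + q = length Xs.
     cochain_comp s p q A B Xs x - s ((-1) ^ (p*q)) (cochain_comp s q p B A Xs x))"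

lemma cochain_comp_eq_0:
  fixes s :: "'k::field_char_0 \<Rightarrow> 'v::ab_group_add \<Rightarrow> 'v"
  assumes A: "A \<in> hom_wedge s s p" and B: "B \<in> hom_wedge s s q" and ne: "p' \<noteq> p \<or> q' \<noteq> q"
  shows "cochain_comp s p' q' A B Xs x = 0"
proof -
  obtain Ys0 :: "('v \<times> 'v) list" where "length Ys0 = p" by (metis length_replicate)
  with A have "Vector_Spaces.linear s s (A Ys0)" by (auto simp: hom_wedge_def)
  then interpret Vector_Spaces.linear s s "A Ys0" .
  have A0: "A Ys y = 0" if "length Ys \<noteq> p" for Ys y
    using A that by (auto simp: hom_wedge_def)
  have B0: "B Ys y = 0" if "length Ys \<noteq> q" for Ys y
    using B that by (auto simp: hom_wedge_def)
  have A_0: "A Ys 0 = 0" for Ys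
  proof (cases "length Ys = p")
    case True
    with A have "Vector_Spaces.linear s s (A Ys)" by (auto simp: hom_wedge_def)
    then interpret Y: Vector_Spaces.linear s s "A Ys" .
    show ?thesis by (rule Y.zero)
  qed (auto simp: A0)
  have lin: "Vector_Spaces.linear s s (\<lambda>u. A (Xs[i := (u, snd (Xs ! i))]) x) \<and>
      Vector_Spaces.linear s s (\<lambda>u. A (Xs[i := (fst (Xs ! i), u)]) x)"
    if "length Xs = p" and "i < p" for Xs x i
    using A that by (simp add: hom_wedge_def)
  have A_l: "A (Ys @ (0, v) # Zs) y = 0" for Ys Zs v y
  proof (cases "length (Ys @ (0, v) # Zs) = p")
    case True
    then have "Vector_Spaces.linear s s
      (\<lambda>u. A ((Ys @ (0, v) # Zs)[length Ys := (u, snd ((Ys @ (0, v) # Zs) ! length Ys))]) y)"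
      using lin[OF True, of "length Ys"] by auto
    then interpret Y: Vector_Spaces.linear s s
      "\<lambda>u. A ((Ys @ (0, v) # Zs)[length Ys := (u, snd ((Ys @ (0, v) # Zs) ! length Ys))]) y" .
    show ?thesis using Y.zero by simp
  qed (auto simp: A0)
  have A_r: "A (Ys @ (v, 0) # Zs) y = 0" for Ys Zs v y
  proof (cases "length (Ys @ (v, 0) # Zs) = p")
    case True
    then have "Vector_Spaces.linear s s
      (\<lambda>u. A ((Ys @ (v, 0) # Zs)[length Ys := (fst ((Ys @ (v, 0) # Zs) ! length Ys), u)]) y)"
      using lin[OF True, of "length Ys"] by auto
    then interpret Y: Vector_Spaces.linear s s
      "\<lambda>u. A ((Ys @ (v, 0) # Zs)[length Ys := (fst ((Ys @ (v, 0) # Zs) ! length Ys), u)]) y" .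
    show ?thesis using Y.zero by simp
  qed (auto simp: A0)
  show ?thesis
  proof (cases "q' = q")
    case True
    with ne show ?thesis
      by (auto simp: cochain_comp_def Let_def A0 intro!: sum.neutral)
  next
    case False
    then show ?thesis
      by (auto simp: cochain_comp_def Let_def A_0 A_l A_r B0 intro!: sum.neutral)
  qed
qed

lemma R_bracket_homogeneous:
  fixes s :: "'k::field_char_0 \<Rightarrow> 'v::ab_group_add \<Rightarrow> 'v"
  assumes A: "A \<in> hom_wedge s s p" and B: "B \<in> hom_wedge s s q"
  shows "R_bracket s A B =
    cochain_comp s p q A B - cochain_scale s ((-1) ^ (p*q)) (cochain_comp s q p B A)"
proof (intro ext)
  fix Xs x
  obtain Ys0 :: "('v \<times> 'v) list" where "length Ys0 = p" by (metis length_replicate)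
  with A have "Vector_Spaces.linear s s (A Ys0)" by (auto simp: hom_wedge_def)
  then interpret Vector_Spaces.linear s s "A Ys0" .
  let ?t = "\<lambda>(p', q'). cochain_comp s p' q' A B Xs x
    - s ((-1) ^ (p'*q')) (cochain_comp s q' p' B A Xs x)"
  have fin: "finite {(p', q'). p' + q' = length Xs}"
    by (rule finite_subset[of _ "{..length Xs} \<times> {..length Xs}"]) auto
  have out: "?t r = 0" if "r \<noteq> (p, q)" for r
    using that by (cases r) (auto simp: cochain_comp_eq_0[OF A B] cochain_comp_eq_0[OF B A])
  have "R_bracket s A B Xs x = sum ?t {(p', q'). p' + q' = length Xs}"
    by (simp add: R_bracket_def)
  also have "\<dots> = ?t (p, q)"
  proof (cases "p + q = length Xs")
    case True
    then have "sum ?t {(p', q'). p' + q' = length Xs} = sum ?t {(p, q)}"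
      by (intro sum.mono_neutral_right fin) (use out in \<open>auto simp del: split_paired_All\<close>)
    then show ?thesis by simp
  next
    case False
    then have "?t (p, q) = 0" by (auto simp: cochain_comp_def)
    with False show ?thesis by (metis (mono_tags, lifting) out sum.neutral mem_Collect_eq case_prod_conv)
  qed
  finally show "R_bracket s A B Xs x = (cochain_comp s p q A B
      - cochain_scale s ((-1) ^ (p*q)) (cochain_comp s q p B A)) Xs x"
    by (simp add: cochain_scale_def)
qed


section \<open>Maurer-Cartan elements and twisting\<close>

text \<open>
  The operations of an \<open>L\<^sub>\<infinity>\<close>-algebra are given by one function \<open>l\<close> on lists; \<open>l\<^sub>k\<close> is its restriction
  to lists of length \<open>k\<close>. \<open>V n\<close> is the component of degree \<open>n\<close>. The sums over all \<open>k\<close> resp. \<open>n\<close> have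
  finitely many nonzero terms when only finitely many \<open>l\<^sub>k\<close> are nonzero.
\<close>

definition maurer_cartan ::
  "('k::field_char_0 \<Rightarrow> 'c::ab_group_add \<Rightarrow> 'c) \<Rightarrow> (nat \<Rightarrow> 'c set) \<Rightarrow> ('c list \<Rightarrow> 'c) \<Rightarrow> 'c \<Rightarrow> bool" where
  "maurer_cartan s V l \<alpha> \<longleftrightarrow> \<alpha> \<in> V 0 \<and>
     Sum_any (\<lambda>k. if k \<ge> 1 then s (1 / fact k) (l (replicate k \<alpha>)) else 0) = 0"

definition twisted ::
  "('k::field_char_0 \<Rightarrow> 'c::ab_group_add \<Rightarrow> 'c) \<Rightarrow> ('c list \<Rightarrow> 'c) \<Rightarrow> 'c \<Rightarrow> 'c list \<Rightarrow> 'c" where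
  "twisted s l f xs = Sum_any (\<lambda>n. s (1 / fact n) (l (replicate n f @ xs)))"


section \<open>The algebra controlling morphisms\<close>

text \<open>
  \<open>F\<close> is regarded as a subspace of the cochains of \<open>g \<oplus> h\<close>, by means of the injective map
  \<open>incl_cochain\<close>, and \<open>F_elem f\<close> is the element of degree 0 given by a linear map \<open>f\<close>.
\<close>

definition incl_cochain ::
  "('g, 'h) cochain \<Rightarrow> ('g \<times> 'h::ab_group_add, 'g::ab_group_add \<times> 'h) cochain" where
  "incl_cochain Q = (\<lambda>Xs x. (0, Q (map (\<lambda>(u, v). (fst u, fst v)) Xs) (fst x)))"

definition F_comp ::
  "('k::field_char_0 \<Rightarrow> 'g::ab_group_add \<Rightarrow> 'g) \<Rightarrow> ('k \<Rightarrow> 'h::ab_group_add \<Rightarrow> 'h) \<Rightarrow> nat \<Rightarrow>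
   ('g \<times> 'h, 'g \<times> 'h) cochain set" where
  "F_comp sg sh n = incl_cochain ` hom_wedge sg sh n"

definition F_elem :: "('g \<Rightarrow> 'h) \<Rightarrow> ('g \<times> 'h::ab_group_add, 'g::ab_group_add \<times> 'h) cochain" where
  "F_elem f = incl_cochain (\<lambda>Xs x. if Xs = [] then f x else 0)"

definition degree1 :: "('v \<Rightarrow> 'v \<Rightarrow> 'v \<Rightarrow> 'v::zero) \<Rightarrow> ('v, 'v) cochain" where
  "degree1 t = (\<lambda>Xs z. case Xs of [(x, y)] \<Rightarrow> t x y z | _ \<Rightarrow> 0)"

definition bracket_g ::
  "('g \<Rightarrow> 'g \<Rightarrow> 'g \<Rightarrow> 'g) \<Rightarrow> ('g::ab_group_add \<times> 'h::ab_group_add, 'g \<times> 'h) cochain" where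
  "bracket_g \<pi> = degree1 (\<lambda>u v w. (\<pi> (fst u) (fst v) (fst w), 0))"

definition bracket_h ::
  "('h \<Rightarrow> 'h \<Rightarrow> 'h \<Rightarrow> 'h) \<Rightarrow> ('g::ab_group_add \<times> 'h::ab_group_add, 'g \<times> 'h) cochain" where
  "bracket_h \<mu> = degree1 (\<lambda>u v w. (0, \<mu> (snd u) (snd v) (snd w)))"

abbreviation F_scale ::
  "('k::field_char_0 \<Rightarrow> 'g::ab_group_add \<Rightarrow> 'g) \<Rightarrow> ('k \<Rightarrow> 'h::ab_group_add \<Rightarrow> 'h) \<Rightarrow>
   'k \<Rightarrow> ('g \<times> 'h, 'g \<times> 'h) cochain \<Rightarrow> ('g \<times> 'h, 'g \<times> 'h) cochain" where
  "F_scale sg sh \<equiv> cochain_scale (module_prod.scale sg sh)"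

definition F_op ::
  "('k::field_char_0 \<Rightarrow> 'g::ab_group_add \<Rightarrow> 'g) \<Rightarrow> ('g \<Rightarrow> 'g \<Rightarrow> 'g \<Rightarrow> 'g) \<Rightarrow>
   ('k \<Rightarrow> 'h::ab_group_add \<Rightarrow> 'h) \<Rightarrow> ('h \<Rightarrow> 'h \<Rightarrow> 'h \<Rightarrow> 'h) \<Rightarrow>
   ('g \<times> 'h, 'g \<times> 'h) cochain list \<Rightarrow> ('g \<times> 'h, 'g \<times> 'h) cochain" where
  "F_op sg \<pi> sh \<mu> as = (let br = R_bracket (module_prod.scale sg sh) in
     case as of
       [a1] \<Rightarrow> br (bracket_g \<pi>) a1
     | [a1, a2, a3] \<Rightarrow> br (br (br (bracket_h \<mu>) a1) a2) a3
     | _ \<Rightarrow> 0)"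

end

(* Evaluated on three arguments, the Maurer-Cartan sum of the twisted operations is
     -f' pi + (1/2) l3(f,f,f') + (1/2) l3(f,f',f') + (1/6) l3(f',f',f').
   As l3(a,b,c) symmetrises mu(a,b,c), adding the equation mu(f,f,f) = f pi turns this into the
   trilinear expansion of mu(f+f',f+f',f+f') - (f+f') pi, the defect of f + f' as a morphism. *)
theory Submission
  imports Defs
begin

section \<open>Brackets of degree 1 with degree 0 cochains\<close>

definition degree0 :: "('v \<Rightarrow> 'v::zero) \<Rightarrow> ('v, 'v) cochain" where
  "degree0 b = (\<lambda>Xs x. if Xs = [] then b x else 0)"

text \<open>For trilinear \<open>t\<close> and linear \<open>b\<close>, the obstruction to
  \<open>b\<close> being a derivation of \<open>t\<close>.\<close>

definition derive1 ::
  "('v \<Rightarrow> 'v \<Rightarrow> 'v \<Rightarrow> 'v) \<Rightarrow> ('v \<Rightarrow> 'v) \<Rightarrow> 'v \<Rightarrow> 'v \<Rightarrow> 'v \<Rightarrow> 'v::ab_group_add" where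
  "derive1 t b = (\<lambda>x y z. t (b x) y z + t x (b y) z + t x y (b z) - b (t x y z))"

text \<open>The consequence of trilinearity that kills compositions in wrong degrees, where the
  inner cochain puts 0 into a slot of \<open>t\<close>. It passes on to \<open>derive1 t b\<close>,
  so brackets can be iterated.\<close>

definition zero_preserving3 :: "('v::zero \<Rightarrow> 'v \<Rightarrow> 'v \<Rightarrow> 'v) \<Rightarrow> bool" where
  "zero_preserving3 t \<longleftrightarrow> (\<forall>x y. t 0 x y = 0 \<and> t x 0 y = 0 \<and> t x y 0 = 0)"

lemma zero_preserving3_derive1:
  "zero_preserving3 t \<Longrightarrow> b 0 = 0 \<Longrightarrow> zero_preserving3 (derive1 t b)"
  by (simp add: zero_preserving3_def derive1_def)

lemma degree1_eq_0: "length Xs \<noteq> 1 \<Longrightarrow> degree1 t Xs x = 0"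
  by (auto simp: degree1_def split: list.splits)

lemma degree1_diff:
  fixes t u :: "'v \<Rightarrow> 'v \<Rightarrow> 'v \<Rightarrow> 'v::ab_group_add"
  shows "degree1 t Xs z - degree1 u Xs z = degree1 (\<lambda>x y z. t x y z - u x y z) Xs z"
  by (auto simp: degree1_def split: list.splits)

lemma degree1_Cons: "degree1 t [(x, y)] z = t x y z"
  by (simp add: degree1_def)

lemma degree1_eq_iff: "degree1 t = degree1 u \<longleftrightarrow> t = u"
  by (metis degree1_Cons ext)

text \<open>Covers S(0,0), S(1,0) and S(0,1), the shuffles met when a degree 1 and a degree 0
  cochain are composed.\<close>

lemma shuffle_perms_le_1:
  assumes "i + j \<le> 1"
  shows "shuffle_perms i j = {id}"
proof -
  from assms have "i + j = 0 \<or> i + j = 1" by linarith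
  then have "\<sigma> permutes {1..i+j} \<longleftrightarrow> \<sigma> = id" for \<sigma>
    by auto
  then show ?thesis
    by (auto simp: shuffle_perms_def strict_mono_on_def)
qed

text \<open>For q = 0 all signs are 1, and the three sums of the composition insert \<open>b\<close>
  into the three slots of \<open>t\<close> in turn.\<close>

lemma cochain_comp_degree1_degree0:
  fixes s :: "'k::field_char_0 \<Rightarrow> 'b::ab_group_add \<Rightarrow> 'b"
    and t :: "'b \<Rightarrow> 'b \<Rightarrow> 'b \<Rightarrow> 'b"
  assumes s: "vector_space s" and t: "zero_preserving3 t" and b: "b 0 = 0"
  shows "cochain_comp s p q (degree1 t) (degree0 b) Xs z =
    (if p = 1 \<and> q = 0
     then degree1 (\<lambda>x y z. t (b x) y z + t x (b y) z + t x y (b z)) Xs z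
     else 0)"
proof -
  interpret vector_space s by fact
  show ?thesis
  proof (cases "p = 1 \<and> q = 0 \<and> length Xs = 1")
    case True
    then obtain x y where "Xs = [(x, y)]"
      by (auto simp: length_Suc_conv)
    with True show ?thesis
      by (simp add: cochain_comp_def Let_def shuffle_perms_le_1 degree1_Cons degree0_def upt_rec)
  next
    case False
    have A0: "degree1 t Ys 0 = 0" for Ys
      using t by (auto simp: degree1_def zero_preserving3_def split: list.splits)
    have A1: "degree1 t (Ys @ (0, v) # Zs) w = 0" "degree1 t (Ys @ (v, 0) # Zs) w = 0" for Ys Zs v w
      using t by (cases Ys; auto simp: degree1_def zero_preserving3_def split: list.splits)+
    have B: "degree0 b Ys y = 0" if "length Ys \<noteq> 0" for Ys y
      using that by (auto simp: degree0_def)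
    \<comment> \<open>For q = 0 the outer \<open>degree1 t\<close> receives p pairs and vanishes
      unless p = 1. For q > 0 the inner \<open>degree0 b\<close> receives q pairs, so a zero enters
      \<open>t\<close>.\<close>
    show ?thesis
    proof (cases "q = 0")
      case True
      with False show ?thesis
        by (auto simp: cochain_comp_def Let_def degree1_eq_0 intro!: sum.neutral)
    next
      case False
      then show ?thesis
        by (auto simp: cochain_comp_def Let_def A0 A1 B intro!: sum.neutral)
    qed
  qed
qed

text \<open>The order \<open>q p\<close> matches the second term of the bracket at index (p, q). For
  q = 0 the sums over k are empty and the last one is plain composition.\<close>

lemma cochain_comp_degree0_degree1:
  fixes s :: "'k::field_char_0 \<Rightarrow> 'b::ab_group_add \<Rightarrow> 'b"
    and t :: "'b \<Rightarrow> 'b \<Rightarrow> 'b \<Rightarrow> 'b"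
  assumes s: "vector_space s" and b: "b 0 = 0"
  shows "cochain_comp s q p (degree0 b) (degree1 t) Xs z =
    (if p = 1 \<and> q = 0 then degree1 (\<lambda>x y z. b (t x y z)) Xs z else 0)"
proof -
  interpret vector_space s by fact
  show ?thesis
  proof (cases "p = 1 \<and> q = 0 \<and> length Xs = 1")
    case True
    then obtain x y where "Xs = [(x, y)]"
      by (auto simp: length_Suc_conv)
    with True show ?thesis
      by (simp add: cochain_comp_def Let_def shuffle_perms_le_1 degree1_Cons degree0_def upt_rec)
  next
    case False
    have A: "degree0 b (Xs @ Y # Ys) y = 0" for Xs Y Ys y
      by (simp add: degree0_def)
    have A0: "degree0 b Ys 0 = 0" for Ys
      using b by (simp add: degree0_def)
    show ?thesis
    proof (cases "q = 0")
      case True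
      with False show ?thesis
        by (auto simp: cochain_comp_def Let_def degree1_eq_0 A0 intro!: sum.neutral)
    next
      case False
      then show ?thesis
        by (auto simp: cochain_comp_def Let_def A degree0_def intro!: sum.neutral)
    qed
  qed
qed

lemma R_bracket_degree1_degree0:
  fixes s :: "'k::field_char_0 \<Rightarrow> 'b::ab_group_add \<Rightarrow> 'b"
    and t :: "'b \<Rightarrow> 'b \<Rightarrow> 'b \<Rightarrow> 'b"
  assumes s: "vector_space s" and t: "zero_preserving3 t" and b: "b 0 = 0"
  shows "R_bracket s (degree1 t) (degree0 b) = degree1 (derive1 t b)"
proof (intro ext)
  interpret vector_space s by fact
  fix Xs z
  let ?t = "\<lambda>(p, q). cochain_comp s p q (degree1 t) (degree0 b) Xs z
    - s ((-1) ^ (p*q)) (cochain_comp s q p (degree0 b) (degree1 t) Xs z)"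
  have "?t = (\<lambda>r. if r = (1, 0) then degree1 (derive1 t b) Xs z else 0)"
    by (simp add: fun_eq_iff cochain_comp_degree1_degree0[OF s t, of b] b
        cochain_comp_degree0_degree1[OF s, of b] derive1_def degree1_diff)
  moreover have "finite {(p, q). p + q = length Xs}"
    by (rule finite_subset[of _ "{..length Xs} \<times> {..length Xs}"]) auto
  \<comment> \<open>The index (1, 0) lies in the summation range exactly for lists of length 1; on
    all others \<open>degree1\<close> is 0.\<close>
  ultimately show "R_bracket s (degree1 t) (degree0 b) Xs z = degree1 (derive1 t b) Xs z"
    unfolding R_bracket_def by (auto simp: degree1_eq_0)
qed

section \<open>The operations on degree 0 elements of F\<close>

lemma F_elem_eq_degree0: "F_elem b = degree0 (\<lambda>u. (0, b (fst u)))"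
  by (auto simp: F_elem_def incl_cochain_def degree0_def fun_eq_iff zero_prod_def)

lemma F_elem_in_F_comp:
  assumes "Vector_Spaces.linear sg sh b"
  shows "F_elem b \<in> F_comp sg sh 0"
  using assms unfolding F_elem_def F_comp_def
  by (intro imageI) (simp add: hom_wedge_def)

lemma three_lie_algebra_br_0:
  assumes "three_lie_algebra s br"
  shows "br 0 y z = 0" "br x 0 z = 0" "br x y 0 = 0"
  using assms[THEN three_lie_algebra.linear_1] assms[THEN three_lie_algebra.linear_2]
    assms[THEN three_lie_algebra.linear_3]
  by (metis Vector_Spaces.linear.axioms module_hom.zero)+

context
  fixes sg :: "'k::field_char_0 \<Rightarrow> 'g::ab_group_add \<Rightarrow> 'g"
    and sh :: "'k \<Rightarrow> 'h::ab_group_add \<Rightarrow> 'h"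
    and \<pi> :: "'g \<Rightarrow> 'g \<Rightarrow> 'g \<Rightarrow> 'g"
    and \<mu> :: "'h \<Rightarrow> 'h \<Rightarrow> 'h \<Rightarrow> 'h"
  assumes g: "three_lie_algebra sg \<pi>"
    and h: "three_lie_algebra sh \<mu>"
begin

interpretation G: three_lie_algebra sg \<pi> by (fact g)
interpretation H: three_lie_algebra sh \<mu> by (fact h)
interpretation GH: vector_space_prod sg sh ..

text \<open>\<open>F_elem b\<close> takes values with zero \<open>'g\<close> component, the only
  component \<open>\<pi>\<close> reads. So the three insertions vanish and only the term with
  \<open>b\<close> outside survives.\<close>

lemma F_op_1:
  assumes "b 0 = 0"
  shows "F_op sg \<pi> sh \<mu> [F_elem b] = degree1 (\<lambda>x y z. (0, - b (\<pi> (fst x) (fst y) (fst z))))"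
proof -
  have "zero_preserving3 (\<lambda>u v w. (\<pi> (fst u) (fst v) (fst w), 0::'h))"
    by (simp add: zero_preserving3_def three_lie_algebra_br_0[OF g] zero_prod_def)
  then show ?thesis
    using assms
    by (simp add: F_op_def F_elem_eq_degree0 bracket_g_def degree1_eq_iff derive1_def
        R_bracket_degree1_degree0[OF GH.p.vector_space_axioms] three_lie_algebra_br_0[OF g]
        zero_prod_def)
qed

text \<open>Maps given by \<open>F_elem\<close> read the \<open>'g\<close> component and write the
  \<open>'h\<close> component. Hence two of them in one slot, or one applied to a value of
  \<open>\<mu>\<close>, give 0; what remains are the six ways to put one map into each slot.\<close>

lemma F_op_3:
  assumes "a 0 = 0" "b 0 = 0" "c 0 = 0"
  shows "F_op sg \<pi> sh \<mu> [F_elem a, F_elem b, F_elem c] =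
    degree1 (\<lambda>u v w. let x = fst u; y = fst v; z = fst w in
     (0, \<mu> (a x) (b y) (c z) + \<mu> (a x) (c y) (b z) + \<mu> (b x) (a y) (c z)
       + \<mu> (b x) (c y) (a z) + \<mu> (c x) (a y) (b z) + \<mu> (c x) (b y) (a z)))"
proof -
  have "zero_preserving3 (\<lambda>u v w. (0::'g, \<mu> (snd u) (snd v) (snd w)))"
    by (simp add: zero_preserving3_def three_lie_algebra_br_0[OF h] zero_prod_def)
  then show ?thesis
    using assms
    by (simp add: F_op_def F_elem_eq_degree0 bracket_h_def degree1_eq_iff
        R_bracket_degree1_degree0[OF GH.p.vector_space_axioms]
        zero_preserving3_derive1 zero_prod_def[symmetric])
      (simp add: derive1_def Let_def fun_eq_iff three_lie_algebra_br_0[OF h] algebra_simps)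
qed

lemma F_op_eq_0: "length as \<noteq> 1 \<Longrightarrow> length as \<noteq> 3 \<Longrightarrow> F_op sg \<pi> sh \<mu> as = 0"
  by (auto simp: F_op_def Let_def split: list.splits)

section \<open>The Maurer-Cartan sum of the twisted operations\<close>

lemma cochain_vector_space: "vector_space (F_scale sg sh)"
  by unfold_locales
    (auto simp: cochain_scale_def fun_eq_iff GH.p.scale_right_distrib GH.p.scale_left_distrib)

interpretation C: vector_space "F_scale sg sh" by (rule cochain_vector_space)

lemma twisted_eq_sum:
  "twisted (F_scale sg sh) (F_op sg \<pi> sh \<mu>) a as =
    (\<Sum>n<4. F_scale sg sh (1 / fact n) (F_op sg \<pi> sh \<mu> (replicate n a @ as)))"
  unfolding twisted_def
proof (rule Sum_any.expand_superset)
  have "n < 4" if "F_op sg \<pi> sh \<mu> (replicate n a @ as) \<noteq> 0" for n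
    using that F_op_eq_0[of "replicate n a @ as"] by fastforce
  then show "{n. F_scale sg sh (1 / fact n) (F_op sg \<pi> sh \<mu> (replicate n a @ as)) \<noteq> 0} \<subseteq> {..<4}"
    by auto
qed simp

text \<open>Only lists of length 1 and 3 contribute. The 1/2 at \<open>[a, a, b]\<close> is the
  twisting factor 1/2! for k = 1, whereas at \<open>[a, b, b]\<close> it is the Maurer-Cartan factor
  1/2! for k = 2.\<close>

lemma maurer_cartan_sum:
  "Sum_any (\<lambda>k. if k \<ge> 1 then F_scale sg sh (1 / fact k)
      (twisted (F_scale sg sh) (F_op sg \<pi> sh \<mu>) a (replicate k b)) else 0) =
    F_op sg \<pi> sh \<mu> [b] + F_scale sg sh (1 / 2) (F_op sg \<pi> sh \<mu> [a, a, b])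
    + F_scale sg sh (1 / 2) (F_op sg \<pi> sh \<mu> [a, b, b])
    + F_scale sg sh (1 / 6) (F_op sg \<pi> sh \<mu> [b, b, b])"
proof -
  let ?T = "\<lambda>k. twisted (F_scale sg sh) (F_op sg \<pi> sh \<mu>) a (replicate k b)"
  let ?f = "\<lambda>k. if k \<ge> 1 then F_scale sg sh (1 / fact k) (?T k) else 0"
  have "?T k = 0" if "k \<ge> 4" for k
    using that by (simp add: twisted_eq_sum F_op_eq_0)
  then have "{k. ?f k \<noteq> 0} \<subseteq> {..<4}"
    using linorder_not_less by auto
  then have "Sum_any ?f = (\<Sum>k<4. ?f k)"
    by (intro Sum_any.expand_superset) simp_all
  also have "\<dots> = ?T 1 + F_scale sg sh (1 / 2) (?T 2) + F_scale sg sh (1 / 6) (?T 3)"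
    by (simp add: eval_nat_numeral fact_numeral)
  also have "?T 1 = F_op sg \<pi> sh \<mu> [b] + F_scale sg sh (1 / 2) (F_op sg \<pi> sh \<mu> [a, a, b])"
    by (simp add: twisted_eq_sum eval_nat_numeral F_op_eq_0)
  also have "?T 2 = F_op sg \<pi> sh \<mu> [a, b, b]"
    by (simp add: twisted_eq_sum eval_nat_numeral F_op_eq_0)
  also have "?T 3 = F_op sg \<pi> sh \<mu> [b, b, b]"
    by (simp add: twisted_eq_sum eval_nat_numeral F_op_eq_0)
  finally show ?thesis .
qed

lemma maurer_cartan_defect:
  assumes f: "three_lie_morphism sg \<pi> sh \<mu> f" and f': "Vector_Spaces.linear sg sh f'"
  shows "Sum_any (\<lambda>k. if k \<ge> 1 then F_scale sg sh (1 / fact k)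
      (twisted (F_scale sg sh) (F_op sg \<pi> sh \<mu>) (F_elem f) (replicate k (F_elem f'))) else 0) =
    degree1 (\<lambda>u v w. let x = fst u; y = fst v; z = fst w in
     (0, \<mu> (f x + f' x) (f y + f' y) (f z + f' z) - (f (\<pi> x y z) + f' (\<pi> x y z))))"
proof (rule trans[OF maurer_cartan_sum], intro ext)
  fix Xs :: "(('g \<times> 'h) \<times> ('g \<times> 'h)) list" and w :: "'g \<times> 'h"
  have f_lin: "Vector_Spaces.linear sg sh f"
    and f_br: "f (\<pi> x y z) = \<mu> (f x) (f y) (f z)" for x y z
    using f by (auto simp: three_lie_morphism_def)
  have f_0: "f 0 = 0" and f'_0: "f' 0 = 0"
    using f_lin f' by (auto simp: Vector_Spaces.linear_def module_hom.zero)
  have add: "\<mu> (a + a') b c = \<mu> a b c + \<mu> a' b c" "\<mu> a (b + b') c = \<mu> a b c + \<mu> a b' c"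
    "\<mu> a b (c + c') = \<mu> a b c + \<mu> a b c'" for a a' b b' c c'
    using H.linear_1 H.linear_2 H.linear_3
    by (meson Vector_Spaces.linear_def module_hom.add)+
  \<comment> \<open>The six-term symmetrisation repeats each distinct term twice when two arguments
    agree and six times when all three do. The nested forms fit the right-associated sums produced
    by \<open>ac_simps\<close>.\<close>
  have half: "sh (1 / 2) v + sh (1 / 2) v = v" for v
    by (simp flip: H.scale_left_distrib)
  have half': "sh (1 / 2) v + (sh (1 / 2) v + u) = v + u" for u v
    by (simp add: half flip: add.assoc)
  have sixth: "sh (1 / 6) v + (sh (1 / 6) v + (sh (1 / 6) v + (sh (1 / 6) v + (sh (1 / 6) v +
      sh (1 / 6) v)))) = v" for v
    by (simp flip: H.scale_left_distrib)
  show "(F_op sg \<pi> sh \<mu> [F_elem f']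
    + F_scale sg sh (1 / 2) (F_op sg \<pi> sh \<mu> [F_elem f, F_elem f, F_elem f'])
    + F_scale sg sh (1 / 2) (F_op sg \<pi> sh \<mu> [F_elem f, F_elem f', F_elem f'])
    + F_scale sg sh (1 / 6) (F_op sg \<pi> sh \<mu> [F_elem f', F_elem f', F_elem f'])) Xs w =
    degree1 (\<lambda>u v w. let x = fst u; y = fst v; z = fst w in
     (0, \<mu> (f x + f' x) (f y + f' y) (f z + f' z) - (f (\<pi> x y z) + f' (\<pi> x y z)))) Xs w"
  proof (cases "length Xs = 1")
    case False
    then show ?thesis
      by (simp add: F_op_1 F_op_3 f_0 f'_0 degree1_eq_0 cochain_scale_def)
  next
    case True
    then obtain u v where "Xs = [(u, v)]"
      by (auto simp: length_Suc_conv)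
    \<comment> \<open>\<open>f_br\<close> makes the pure \<open>f\<close> term of the expansion
      cancel against \<open>f (\<pi> x y z)\<close>.\<close>
    then show ?thesis
      by (simp add: F_op_1 F_op_3 f_0 f'_0 degree1_Cons cochain_scale_def Let_def GH.scale_prod
          H.scale_right_distrib add f_br half half' sixth ac_simps)
  qed
qed

end

theorem corollary2p13:
  fixes sg :: "'k::field_char_0 \<Rightarrow> 'g::ab_group_add \<Rightarrow> 'g"
    and sh :: "'k \<Rightarrow> 'h::ab_group_add \<Rightarrow> 'h"
    and \<pi> :: "'g \<Rightarrow> 'g \<Rightarrow> 'g \<Rightarrow> 'g"
    and \<mu> :: "'h \<Rightarrow> 'h \<Rightarrow> 'h \<Rightarrow> 'h"
    and f f' :: "'g \<Rightarrow> 'h"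
  assumes "three_lie_algebra sg \<pi>"
    and "three_lie_algebra sh \<mu>"
    and "three_lie_morphism sg \<pi> sh \<mu> f"
    and "Vector_Spaces.linear sg sh f'"
  shows "three_lie_morphism sg \<pi> sh \<mu> (\<lambda>x. f x + f' x) \<longleftrightarrow>
    maurer_cartan (F_scale sg sh) (F_comp sg sh)
      (twisted (F_scale sg sh) (F_op sg \<pi> sh \<mu>) (F_elem f)) (F_elem f')"
proof -
  let ?d = "\<lambda>x y z. \<mu> (f x + f' x) (f y + f' y) (f z + f' z) - (f (\<pi> x y z) + f' (\<pi> x y z))"
  interpret G: three_lie_algebra sg \<pi> by fact
  interpret H: three_lie_algebra sh \<mu> by fact
  interpret GH: vector_space_pair sg sh ..
  have "Vector_Spaces.linear sg sh (\<lambda>x. f x + f' x)"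
    using assms(3,4) GH.linear_compose_add by (auto simp: three_lie_morphism_def)
  then have "three_lie_morphism sg \<pi> sh \<mu> (\<lambda>x. f x + f' x) \<longleftrightarrow> (\<forall>x y z. ?d x y z = 0)"
    by (auto simp: three_lie_morphism_def)
  \<comment> \<open>Every element of \<open>'g\<close> is the first component of some pair, so
    equality of these cochains on the direct sum tests all x, y, z.\<close>
  also have "\<dots> \<longleftrightarrow> degree1 (\<lambda>u v w. let x = fst u; y = fst v; z = fst w in (0::'g, ?d x y z)) =
      degree1 (\<lambda>(u::'g\<times>'h) (v::'g\<times>'h) (w::'g\<times>'h). 0)"
    unfolding degree1_eq_iff by (auto simp: fun_eq_iff zero_prod_def Let_def)
  also have "degree1 (\<lambda>(u::'g\<times>'h) (v::'g\<times>'h) (w::'g\<times>'h). 0) = 0"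
    by (auto simp: degree1_def fun_eq_iff split: list.splits)
  \<comment> \<open>Linearity of \<open>f'\<close> gives the degree 0 condition, which leaves only
    the equation.\<close>
  finally show ?thesis
    using F_elem_in_F_comp[OF assms(4)]
    unfolding maurer_cartan_def maurer_cartan_defect[OF assms] by (simp add: zero_fun_def)
qed

end
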